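(* Let $\xi_1$ be a real random variable with distribution $\mu$, finite fourth moment, and cumulative distribution function $F$. Let $\xi_1,\dots,\xi_N$ be mutually independent copies of $\xi_1$, giving an empirical measure $L_N^\xi=N^{-1}\sum_{j=1}^N\delta_{\xi_j}$ with cumulative distribution function $F_N^\xi(t)$. Then $$\int_{\mathbb R^N}W_1(F_N^\xi,F)\,\mu^{\otimes N}(d\xi)\le\frac1{\sqrt N}\int_{-\infty}^\infty\sqrt{F(t)(1-F(t))}\,dt.$$
   Context: For probability distributions on $\mathbb R$ with cumulative distribution functions $F$ and $G$, $W_1(F,G)$ denotes the Wasserstein distance of order $1$ between the distributions for the cost function $|x-y|$. *)

theory Defs
  imports "HOL-Probability.Probability"
begin

text \<open>
  Total mass and positivity need not be required of a coupling: if the marginals are probability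
  measures, so is every coupling.
\<close>

definition couplings :: "real measure \<Rightarrow> real measure \<Rightarrow> (real \<times> real) measure set" where
  "couplings \<mu> \<nu> = {\<pi>. sets \<pi> = sets (borel \<Otimes>\<^sub>M borel) \<and>
                        distr \<pi> borel fst = \<mu> \<and> distr \<pi> borel snd = \<nu>}"

text \<open>
  The transport cost takes values in \<^typ>\<open>ennreal\<close>, so that no finiteness has to be assumed
  for the infimum to be meaningful.
\<close>

definition wasserstein1 :: "real measure \<Rightarrow> real measure \<Rightarrow> ennreal" where
  "wasserstein1 \<mu> \<nu> = (INF \<pi>\<in>couplings \<mu> \<nu>. \<integral>\<^sup>+ (x, y). ennreal \<bar>x - y\<bar> \<partial>\<pi>)"

text \<open>
  The normalised sum of point masses at the sample points, as the image of the uniform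
  distribution on the indices; \<open>emeasure_empirical_measure\<close> gives the usual formula.
\<close>

definition empirical_measure :: "nat \<Rightarrow> (nat \<Rightarrow> real) \<Rightarrow> real measure" where
  "empirical_measure N \<xi> = distr (uniform_count_measure {1..N}) borel \<xi>"

lemma emeasure_empirical_measure:
  assumes "N \<ge> 1" and "A \<in> sets borel"
  shows "emeasure (empirical_measure N \<xi>) A =
           ennreal (1 / real N) * (\<Sum>j\<in>{1..N}. emeasure (return borel (\<xi> j)) A)"
proof -
  have "emeasure (empirical_measure N \<xi>) A =
      emeasure (uniform_count_measure {1..N}) (\<xi> -` A \<inter> {1..N})"
    unfolding empirical_measure_def using assms(2)
    by (subst emeasure_distr) (auto simp: space_uniform_count_measure measurable_def
        sets_uniform_count_measure)
  also have "\<dots> = ennreal (real (card (\<xi> -` A \<inter> {1..N})) / real N)"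
    by (subst emeasure_uniform_count_measure) auto
  also have "(\<Sum>j\<in>{1..N}. emeasure (return borel (\<xi> j)) A) =
      (\<Sum>j\<in>{1..N}. indicator (\<xi> -` A) j)"
    using assms(2) by (intro sum.cong) (auto simp: indicator_def)
  then have "(\<Sum>j\<in>{1..N}. emeasure (return borel (\<xi> j)) A) =
      ennreal (real (card (\<xi> -` A \<inter> {1..N})))"
    by (simp add: indicator_def sum.If_cases vimage_def Int_def conj_commute
        flip: ennreal_of_nat_eq_real_of_nat)
  then have "ennreal (real (card (\<xi> -` A \<inter> {1..N})) / real N) =
      ennreal (1 / real N) * (\<Sum>j\<in>{1..N}. emeasure (return borel (\<xi> j)) A)"
    by (simp add: ennreal_mult[symmetric] del: emeasure_return)
  finally show ?thesis .
qed

end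

theory Submission
  imports Defs
begin

text \<open>
  On the real line the Wasserstein distance of order \<open>1\<close> equals the \<open>L\<^sup>1\<close> distance of the
  distribution functions (\<open>wasserstein1_eq_nn_integral_cdf\<close>). The inequality in one direction
  holds for every coupling, and the quantile coupling attains it; both follow by writing
  \<open>\<bar>x - y\<bar>\<close> as the measure of the set of levels \<open>t\<close> that separate \<open>x\<close> from \<open>y\<close>. This formula also
  shows that \<open>W\<^sub>1\<close> depends measurably on the sample, since the empirical distribution function is
  jointly measurable in the sample and the level.

  By Tonelli's theorem the expected distance is the integral over \<open>t\<close> of the mean absolute
  deviation of the empirical distribution function at \<open>t\<close> from \<open>F t\<close>. The empirical distribution
  function at \<open>t\<close> is an average of \<open>N\<close> independent Bernoulli variables with mean \<open>F t\<close>, so this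
  deviation is at most its standard deviation, the square root of \<open>F t * (1 - F t) / N\<close>
  (\<open>nn_integral_abs_cdf_empirical_diff_le\<close>). The right-hand side is a finite integral because
  the fourth moment makes the square root of \<open>F t * (1 - F t)\<close> decay at least as fast as
  a multiple of \<open>1 / t\<^sup>2\<close> (\<open>integrable_sqrt_cdf\<close>).
\<close>

section \<open>The Wasserstein distance in terms of distribution functions\<close>

lemma abs_diff_eq_nn_integral_indicator:
  fixes x y :: real
  shows "ennreal \<bar>x - y\<bar> =
    (\<integral>\<^sup>+ t. ennreal \<bar>indicat_real {..t} x - indicat_real {..t} y\<bar> \<partial>lborel)"
proof -
  have "(\<integral>\<^sup>+ t. ennreal \<bar>indicat_real {..t} x - indicat_real {..t} y\<bar> \<partial>lborel)
      = (\<integral>\<^sup>+ t. indicator {min x y..<max x y} t \<partial>lborel)"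
    by (intro nn_integral_cong) (auto simp: indicator_def min_def max_def)
  also have "\<dots> = ennreal (max x y - min x y)"
    by (simp add: emeasure_lborel_Ico)
  finally show ?thesis
    by (simp add: max_def min_def abs_if)
qed

text \<open>
  Joint measurability in the point and the threshold; with \<^term>\<open>{..g x}\<close> depending on the
  argument, the measurability rules for indicators of a fixed set do not apply.
\<close>

lemma measurable_indicator_atMost [measurable (raw)]:
  fixes f g :: "'a \<Rightarrow> real"
  assumes [measurable]: "f \<in> borel_measurable M" "g \<in> borel_measurable M"
  shows "(\<lambda>x. indicat_real {..g x} (f x)) \<in> borel_measurable M"
proof -
  have "(\<lambda>x. indicat_real {..g x} (f x)) = (\<lambda>x. if f x \<le> g x then 1 else 0)"
    by (auto simp: indicator_def)
  also have "\<dots> \<in> borel_measurable M"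
    by measurable
  finally show ?thesis .
qed

lemma prob_space_coupling:
  assumes "prob_space \<mu>" "\<pi> \<in> couplings \<mu> \<nu>"
  shows "prob_space \<pi>"
proof -
  have *: "sets \<pi> = sets (borel \<Otimes>\<^sub>M borel)" "distr \<pi> borel fst = \<mu>"
    using assms(2) by (auto simp: couplings_def)
  have "fst \<in> measurable \<pi> borel"
    by (simp add: measurable_cong_sets[OF *(1) refl])
  then show ?thesis
    using prob_space_distrD[of fst \<pi> borel] assms(1) *(2) by simp
qed

text \<open>
  Used for every coupling: the expected distance of two random variables on a common probability space is the
  integral over all levels \<open>t\<close> of the probability that exactly one of them is at most \<open>t\<close>.
\<close>

lemma nn_integral_abs_diff_eq_indicator:
  fixes M :: "'a measure" and X Y :: "'a \<Rightarrow> real"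
  assumes "prob_space M"
    and [measurable]: "X \<in> borel_measurable M" "Y \<in> borel_measurable M"
  shows "(\<integral>\<^sup>+ \<omega>. ennreal \<bar>X \<omega> - Y \<omega>\<bar> \<partial>M) =
    (\<integral>\<^sup>+ t. \<integral>\<^sup>+ \<omega>. ennreal \<bar>indicat_real {..t} (X \<omega>) - indicat_real {..t} (Y \<omega>)\<bar> \<partial>M \<partial>lborel)"
proof -
  interpret M: prob_space M by fact
  interpret pair_sigma_finite M lborel ..
  have "(\<integral>\<^sup>+ \<omega>. ennreal \<bar>X \<omega> - Y \<omega>\<bar> \<partial>M) =
    (\<integral>\<^sup>+ \<omega>. \<integral>\<^sup>+ t. ennreal \<bar>indicat_real {..t} (X \<omega>) - indicat_real {..t} (Y \<omega>)\<bar> \<partial>lborel \<partial>M)"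
    by (rule nn_integral_cong) (rule abs_diff_eq_nn_integral_indicator)
  also have "\<dots> =
    (\<integral>\<^sup>+ t. \<integral>\<^sup>+ \<omega>. ennreal \<bar>indicat_real {..t} (X \<omega>) - indicat_real {..t} (Y \<omega>)\<bar> \<partial>M \<partial>lborel)"
    by (rule Fubini'[symmetric]) measurable
  finally show ?thesis .
qed

text \<open>
  On the line, \<open>W\<^sub>1\<close> is the \<open>L\<^sup>1\<close> distance of the distribution functions. At each level \<open>t\<close> any
  coupling separates the two coordinates with probability at least the absolute difference
  of the distribution functions at \<open>t\<close>. Equality holds for the pair of quantile functions on \<open>(0,1)\<close>:
  the first quantile is at most \<open>t\<close> exactly at the points of \<open>(0,1)\<close> up to \<open>cdf \<mu> t\<close>, and the
  second exactly at those up to \<open>cdf \<nu> t\<close>, so \<open>t\<close> separates them exactly between these two values.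
\<close>

lemma wasserstein1_eq_nn_integral_cdf:
  assumes "real_distribution \<mu>" "real_distribution \<nu>"
  shows "wasserstein1 \<mu> \<nu> = (\<integral>\<^sup>+ t. ennreal \<bar>cdf \<mu> t - cdf \<nu> t\<bar> \<partial>lborel)"
proof (rule antisym)
  interpret M: cdf_distribution \<mu> using assms(1) by (simp add: cdf_distribution_def)
  interpret N: cdf_distribution \<nu> using assms(2) by (simp add: cdf_distribution_def)
  show "(\<integral>\<^sup>+ t. ennreal \<bar>cdf \<mu> t - cdf \<nu> t\<bar> \<partial>lborel) \<le> wasserstein1 \<mu> \<nu>"
    unfolding wasserstein1_def
  proof (rule INF_greatest)
    fix \<pi> assume \<pi>: "\<pi> \<in> couplings \<mu> \<nu>"
    then have sets [measurable_cong]: "sets \<pi> = sets (borel \<Otimes>\<^sub>M borel)"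
      and fst: "distr \<pi> borel fst = \<mu>" and snd: "distr \<pi> borel snd = \<nu>"
      by (auto simp: couplings_def)
    interpret P: prob_space \<pi>
      using prob_space_coupling[OF _ \<pi>] M.prob_space_axioms by blast
    have "ennreal \<bar>cdf \<mu> t - cdf \<nu> t\<bar> \<le>
        (\<integral>\<^sup>+ p. ennreal \<bar>indicat_real {..t} (fst p) - indicat_real {..t} (snd p)\<bar> \<partial>\<pi>)" for t
    proof -
      have int: "integrable \<pi> (\<lambda>p. indicat_real {..t} (f p))"
        if [measurable]: "f \<in> borel_measurable \<pi>" for f
        by (rule P.integrable_const_bound[where B = 1]) (auto simp: indicator_def)
      have cdf: "cdf (distr \<pi> borel f) t = (\<integral>p. indicat_real {..t} (f p) \<partial>\<pi>)"
        if f: "f \<in> borel_measurable \<pi>" for f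
        using integral_distr[OF f, of "indicat_real {..t}"] by (simp add: cdf_def)
      have "cdf \<mu> t - cdf \<nu> t =
          (\<integral>p. indicat_real {..t} (fst p) \<partial>\<pi>) - (\<integral>p. indicat_real {..t} (snd p) \<partial>\<pi>)"
        using cdf[of fst] cdf[of snd] by (simp add: fst snd)
      then have "cdf \<mu> t - cdf \<nu> t =
          (\<integral>p. indicat_real {..t} (fst p) - indicat_real {..t} (snd p) \<partial>\<pi>)"
        by (simp add: Bochner_Integration.integral_diff int)
      then have "\<bar>cdf \<mu> t - cdf \<nu> t\<bar> \<le>
          (\<integral>p. \<bar>indicat_real {..t} (fst p) - indicat_real {..t} (snd p)\<bar> \<partial>\<pi>)"
        by (simp add: integral_abs_bound)
      also have "ennreal \<dots> =
        (\<integral>\<^sup>+ p. ennreal \<bar>indicat_real {..t} (fst p) - indicat_real {..t} (snd p)\<bar> \<partial>\<pi>)"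
        by (intro nn_integral_eq_integral[symmetric])
          (auto intro!: integrable_abs Bochner_Integration.integrable_diff int[of fst] int[of snd])
      finally show ?thesis
        by (simp add: ennreal_leI)
    qed
    then have "(\<integral>\<^sup>+ t. ennreal \<bar>cdf \<mu> t - cdf \<nu> t\<bar> \<partial>lborel) \<le>
        (\<integral>\<^sup>+ t. \<integral>\<^sup>+ p. ennreal \<bar>indicat_real {..t} (fst p) - indicat_real {..t} (snd p)\<bar> \<partial>\<pi> \<partial>lborel)"
      by (rule nn_integral_mono)
    also have "\<dots> = (\<integral>\<^sup>+ p. ennreal \<bar>fst p - snd p\<bar> \<partial>\<pi>)"
      by (rule nn_integral_abs_diff_eq_indicator[OF P.prob_space_axioms, symmetric]) simp_all
    finally show "(\<integral>\<^sup>+ t. ennreal \<bar>cdf \<mu> t - cdf \<nu> t\<bar> \<partial>lborel) \<le>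
        (\<integral>\<^sup>+ (x, y). ennreal \<bar>x - y\<bar> \<partial>\<pi>)"
      by (simp add: case_prod_unfold)
  qed

  \<comment> \<open>The quantile coupling; \<open>I\<close> denotes the generalised inverse of the distribution function.\<close>
  define U where "U = restrict_space lborel {0<..<1::real}"
  define \<pi> where "\<pi> = distr U (borel \<Otimes>\<^sub>M borel) (\<lambda>u. (M.I u, N.I u))"
  interpret U: prob_space U
  proof (rule prob_spaceI)
    show "emeasure U (space U) = 1"
      by (simp add: U_def emeasure_restrict_space space_restrict_space)
  qed
  have sets_U: "sets U = sets (restrict_space borel {0<..<1})"
    by (simp add: U_def sets_restrict_space)
  have [measurable]: "M.I \<in> borel_measurable U" "N.I \<in> borel_measurable U"
    unfolding measurable_cong_sets[OF sets_U refl] by (rule M.measurable_CI N.measurable_CI)+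
  have "distr \<pi> borel fst = distr U borel M.I"
    unfolding \<pi>_def by (subst distr_distr) (simp_all add: o_def)
  also have "\<dots> = \<mu>"
    unfolding U_def by (rule M.distr_I_eq_M)
  finally have fst: "distr \<pi> borel fst = \<mu>" .
  have "distr \<pi> borel snd = distr U borel N.I"
    unfolding \<pi>_def by (subst distr_distr) (simp_all add: o_def)
  also have "\<dots> = \<nu>"
    unfolding U_def by (rule N.distr_I_eq_M)
  finally have "distr \<pi> borel snd = \<nu>" .
  with fst have "\<pi> \<in> couplings \<mu> \<nu>"
    by (simp add: couplings_def \<pi>_def)
  then have "wasserstein1 \<mu> \<nu> \<le> (\<integral>\<^sup>+ (x, y). ennreal \<bar>x - y\<bar> \<partial>\<pi>)"
    unfolding wasserstein1_def by (rule INF_lower)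
  also have "\<dots> = (\<integral>\<^sup>+ u. ennreal \<bar>M.I u - N.I u\<bar> \<partial>U)"
    unfolding \<pi>_def by (subst nn_integral_distr) auto
  also have "\<dots> =
      (\<integral>\<^sup>+ t. \<integral>\<^sup>+ u. ennreal \<bar>indicat_real {..t} (M.I u) - indicat_real {..t} (N.I u)\<bar> \<partial>U \<partial>lborel)"
    by (rule nn_integral_abs_diff_eq_indicator[OF U.prob_space_axioms]) simp_all
  also have "\<dots> \<le> (\<integral>\<^sup>+ t. ennreal \<bar>cdf \<mu> t - cdf \<nu> t\<bar> \<partial>lborel)"
  proof (rule nn_integral_mono)
    fix t :: real
    let ?J = "{min (cdf \<mu> t) (cdf \<nu> t)<..max (cdf \<mu> t) (cdf \<nu> t)}"
    have "(\<integral>\<^sup>+ u. ennreal \<bar>indicat_real {..t} (M.I u) - indicat_real {..t} (N.I u)\<bar> \<partial>U)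
        = (\<integral>\<^sup>+ u. indicator ?J u \<partial>U)"
    proof (rule nn_integral_cong)
      fix u assume "u \<in> space U"
      then have u: "0 < u" "u < 1"
        by (auto simp: U_def space_restrict_space)
      have *: "ennreal \<bar>indicat_real {..a} u - indicat_real {..b} u\<bar> =
          indicator {min a b<..max a b} u" for a b
        by (auto simp: indicator_def min_def max_def)
      have "indicat_real {..t} (M.I u) = indicat_real {..cdf \<mu> t} u"
        "indicat_real {..t} (N.I u) = indicat_real {..cdf \<nu> t} u"
        by (simp_all only: indicator_def atMost_iff
            M.pseudoinverse[OF u, of t] N.pseudoinverse[OF u, of t])
      then show "ennreal \<bar>indicat_real {..t} (M.I u) - indicat_real {..t} (N.I u)\<bar> = indicator ?J u"
        by (simp only: *)
    qed
    also have "\<dots> = (\<integral>\<^sup>+ u. indicator ?J u * indicator {0<..<1} u \<partial>lborel)"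
      unfolding U_def by (rule nn_integral_restrict_space) simp
    also have "\<dots> \<le> (\<integral>\<^sup>+ u. indicator ?J u \<partial>lborel)"
      by (rule nn_integral_mono) (auto simp: indicator_def)
    also have "\<dots> = ennreal (max (cdf \<mu> t) (cdf \<nu> t) - min (cdf \<mu> t) (cdf \<nu> t))"
      by simp
    also have "\<dots> = ennreal \<bar>cdf \<mu> t - cdf \<nu> t\<bar>"
      by (simp add: max_def min_def)
    finally show "(\<integral>\<^sup>+ u. ennreal \<bar>indicat_real {..t} (M.I u) - indicat_real {..t} (N.I u)\<bar> \<partial>U)
        \<le> ennreal \<bar>cdf \<mu> t - cdf \<nu> t\<bar>" .
  qed
  finally show "wasserstein1 \<mu> \<nu> \<le> (\<integral>\<^sup>+ t. ennreal \<bar>cdf \<mu> t - cdf \<nu> t\<bar> \<partial>lborel)" .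
qed

section \<open>Empirical measures\<close>

lemma real_distribution_empirical_measure:
  assumes "N \<ge> 1"
  shows "real_distribution (empirical_measure N \<xi>)"
proof -
  have "prob_space (uniform_count_measure {1..N})"
    using assms by (intro prob_space_uniform_count_measure) auto
  then have "prob_space (empirical_measure N \<xi>)"
    unfolding empirical_measure_def
    by (rule prob_space.prob_space_distr)
      (auto simp: measurable_def sets_uniform_count_measure space_uniform_count_measure)
  then show ?thesis
    by (simp add: real_distribution_def real_distribution_axioms_def empirical_measure_def)
qed

lemma cdf_empirical_measure:
  "cdf (empirical_measure N \<xi>) t = (\<Sum>j\<in>{1..N}. indicat_real {..t} (\<xi> j)) / real N"
proof -
  have "cdf (empirical_measure N \<xi>) t =
      measure (uniform_count_measure {1..N}) (\<xi> -` {..t} \<inter> {1..N})"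
    unfolding cdf_def empirical_measure_def
    by (subst measure_distr)
      (auto simp: measurable_def sets_uniform_count_measure space_uniform_count_measure)
  also have "\<dots> = real (card (\<xi> -` {..t} \<inter> {1..N})) / real N"
    by (subst measure_uniform_count_measure) auto
  also have "real (card (\<xi> -` {..t} \<inter> {1..N})) = (\<Sum>j\<in>{1..N}. indicat_real {..t} (\<xi> j))"
    by (simp add: indicator_def sum.If_cases vimage_def Int_def conj_commute)
  finally show ?thesis .
qed

section \<open>Mean deviation of the empirical distribution function\<close>

lemma (in prob_space) expectation_abs_le_sqrt:
  fixes X :: "'a \<Rightarrow> real"
  assumes "integrable M X" "integrable M (\<lambda>x. (X x)\<^sup>2)"
  shows "expectation (\<lambda>x. \<bar>X x\<bar>) \<le> sqrt (expectation (\<lambda>x. (X x)\<^sup>2))"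
proof (rule real_le_rsqrt)
  have "variance (\<lambda>x. \<bar>X x\<bar>) = expectation (\<lambda>x. (X x)\<^sup>2) - (expectation (\<lambda>x. \<bar>X x\<bar>))\<^sup>2"
    using assms by (subst variance_eq) auto
  then show "(expectation (\<lambda>x. \<bar>X x\<bar>))\<^sup>2 \<le> expectation (\<lambda>x. (X x)\<^sup>2)"
    using variance_positive[of "\<lambda>x. \<bar>X x\<bar>"] by simp
qed

text \<open>Variances of independent copies add, stated for a centred function of the coordinates.\<close>

lemma (in prob_space) integral_PiM_sum_squared:
  fixes f :: "'a \<Rightarrow> real" and I :: "'i set"
  assumes "finite I"
    and f: "integrable M f" and f2: "integrable M (\<lambda>x. (f x)\<^sup>2)" and 0: "expectation f = 0"
  shows integrable_PiM_sum_squared: "integrable (\<Pi>\<^sub>M i\<in>I. M) (\<lambda>\<xi>. (\<Sum>i\<in>I. f (\<xi> i))\<^sup>2)"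
    and expectation_PiM_sum_squared:
      "(\<integral>\<xi>. (\<Sum>i\<in>I. f (\<xi> i))\<^sup>2 \<partial>(\<Pi>\<^sub>M i\<in>I. M)) = real (card I) * expectation (\<lambda>x. (f x)\<^sup>2)"
proof -
  interpret P: product_sigma_finite "\<lambda>_. M" ..
  have eq: "(\<Sum>i\<in>I. f (\<xi> i))\<^sup>2 = (\<Sum>i\<in>I. \<Sum>j\<in>I. f (\<xi> i) * f (\<xi> j))" for \<xi>
    by (simp add: power2_eq_square sum_product)
  have *: "integrable (\<Pi>\<^sub>M i\<in>I. M) (\<lambda>\<xi>. f (\<xi> i) * f (\<xi> j)) \<and>
    (\<integral>\<xi>. f (\<xi> i) * f (\<xi> j) \<partial>(\<Pi>\<^sub>M i\<in>I. M)) = (if i = j then expectation (\<lambda>x. (f x)\<^sup>2) else 0)"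
    if ij: "i \<in> I" "j \<in> I" for i j
  proof -
    \<comment> \<open>A product over all coordinates with value \<open>f (\<xi> i) * f (\<xi> j)\<close>, also when \<open>i = j\<close>\<close>
    define h where "h k x = (if k = i then f x else 1) * (if k = j then f x else 1)" for k x
    have prod: "(\<Prod>k\<in>I. h k (\<xi> k)) = f (\<xi> i) * f (\<xi> j)" for \<xi>
      using ij \<open>finite I\<close> by (simp add: h_def prod.distrib)
    have int: "integrable M (h k)" for k
      using f f2 unfolding h_def by (cases "k = i"; cases "k = j") (auto simp: power2_eq_square)
    have "(\<Prod>k\<in>I. expectation (h k)) = (if i = j then expectation (\<lambda>x. (f x)\<^sup>2) else 0)"
    proof (cases "i = j")
      case True
      have "(\<Prod>k\<in>I. expectation (h k)) = (\<Prod>k\<in>I. if k = i then expectation (\<lambda>x. (f x)\<^sup>2) else 1)"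
        using True by (intro prod.cong) (auto simp: h_def[abs_def] power2_eq_square prob_space)
      then show ?thesis using True ij \<open>finite I\<close> by simp
    next
      case False
      then have "expectation (h i) = 0"
        using 0 by (simp add: h_def[abs_def])
      then show ?thesis using False ij \<open>finite I\<close> by (auto intro!: prod_zero)
    qed
    then show ?thesis
      using P.product_integrable_prod[OF \<open>finite I\<close>, of h]
        P.product_integral_prod[OF \<open>finite I\<close>, of h] int by (simp add: prod)
  qed
  show "integrable (\<Pi>\<^sub>M i\<in>I. M) (\<lambda>\<xi>. (\<Sum>i\<in>I. f (\<xi> i))\<^sup>2)"
    unfolding eq using * by (intro Bochner_Integration.integrable_sum) blast
  have "(\<integral>\<xi>. (\<Sum>i\<in>I. f (\<xi> i))\<^sup>2 \<partial>(\<Pi>\<^sub>M i\<in>I. M)) =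
      (\<Sum>i\<in>I. \<Sum>j\<in>I. if i = j then expectation (\<lambda>x. (f x)\<^sup>2) else 0)"
    unfolding eq using *
    by (subst Bochner_Integration.integral_sum)
      (auto intro!: sum.cong Bochner_Integration.integrable_sum simp: Bochner_Integration.integral_sum)
  also have "\<dots> = real (card I) * expectation (\<lambda>x. (f x)\<^sup>2)"
    using \<open>finite I\<close> by simp
  finally show "(\<integral>\<xi>. (\<Sum>i\<in>I. f (\<xi> i))\<^sup>2 \<partial>(\<Pi>\<^sub>M i\<in>I. M)) = real (card I) * expectation (\<lambda>x. (f x)\<^sup>2)" .
qed

text \<open>
  At a fixed level \<open>t\<close> the empirical distribution function is an average of \<open>N\<close> independent
  Bernoulli variables with success probability \<open>cdf M t\<close>.
\<close>

lemma (in real_distribution) nn_integral_abs_cdf_empirical_diff_le: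
  assumes "N \<ge> 1"
  shows "(\<integral>\<^sup>+ \<xi>. ennreal \<bar>cdf (empirical_measure N \<xi>) t - cdf M t\<bar> \<partial>(\<Pi>\<^sub>M j\<in>{1..N}. M))
    \<le> ennreal (1 / sqrt (real N) * sqrt (cdf M t * (1 - cdf M t)))"
proof -
  let ?P = "\<Pi>\<^sub>M j\<in>{1..N}. M" and ?F = "cdf M t"
  interpret P: product_prob_space "\<lambda>_. M" "{1..N}" ..
  define f where "f x = indicat_real {..t} x - ?F" for x
  have f_meas [measurable]: "f \<in> borel_measurable M"
    unfolding f_def by measurable
  have ind: "integrable M (indicat_real {..t})" "expectation (indicat_real {..t}) = ?F"
    by (simp_all add: cdf_def integrable_indicator_iff emeasure_eq_measure)
  have f: "integrable M f" and f0: "expectation f = 0"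
    using ind prob_space by (simp_all add: f_def[abs_def])
  \<comment> \<open>An indicator is its own square, so the square of \<open>f\<close> is affine in it.\<close>
  have sq: "(f x)\<^sup>2 = (1 - 2 * ?F) * indicat_real {..t} x + ?F\<^sup>2" for x
    by (simp add: f_def indicator_def power2_eq_square algebra_simps)
  have f2: "integrable M (\<lambda>x. (f x)\<^sup>2)" and var: "expectation (\<lambda>x. (f x)\<^sup>2) = ?F * (1 - ?F)"
    unfolding sq using ind prob_space by (simp_all add: power2_eq_square algebra_simps)
  let ?S = "\<lambda>\<xi>. (\<Sum>j\<in>{1..N}. f (\<xi> j))"
  have S2: "integrable ?P (\<lambda>\<xi>. (?S \<xi>)\<^sup>2)"
    and ES2: "(\<integral>\<xi>. (?S \<xi>)\<^sup>2 \<partial>?P) = real N * (?F * (1 - ?F))"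
    using integral_PiM_sum_squared[OF _ f f2 f0, of "{1..N}"] by (simp_all add: var)
  have S: "integrable ?P ?S"
    by (rule P.P.square_integrable_imp_integrable[OF _ S2]) measurable
  have "cdf (empirical_measure N \<xi>) t - ?F = ?S \<xi> / real N" for \<xi>
    using assms by (simp add: cdf_empirical_measure f_def sum_subtractf diff_divide_distrib)
  then have diff: "\<bar>cdf (empirical_measure N \<xi>) t - ?F\<bar> = \<bar>?S \<xi>\<bar> / real N" for \<xi>
    by simp
  have "(\<integral>\<^sup>+ \<xi>. ennreal \<bar>cdf (empirical_measure N \<xi>) t - ?F\<bar> \<partial>?P) = ennreal (\<integral>\<xi>. \<bar>?S \<xi>\<bar> / real N \<partial>?P)"
    unfolding diff using S by (intro nn_integral_eq_integral) auto
  also have "(\<integral>\<xi>. \<bar>?S \<xi>\<bar> / real N \<partial>?P) \<le> sqrt (real N * (?F * (1 - ?F))) / real N"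
    using P.P.expectation_abs_le_sqrt[OF S S2] unfolding ES2 by (simp add: divide_right_mono)
  also have "\<dots> = sqrt (real N) / real N * sqrt (?F * (1 - ?F))"
    by (simp add: real_sqrt_mult)
  also have "sqrt (real N) / real N = 1 / sqrt (real N)"
    by (simp add: sqrt_divide_self_eq inverse_eq_divide)
  finally show ?thesis
    by (simp add: ennreal_leI)
qed

section \<open>Integrability of the limiting standard deviation\<close>

text \<open>
  The fourth moment bounds both tails by a multiple of \<open>1 / t\<^sup>4\<close>, so the square root is dominated by
  a multiple of \<open>1 / (1 + t\<^sup>2)\<close>.
\<close>

lemma (in real_distribution) integrable_sqrt_cdf:
  assumes "integrable M (\<lambda>x. x ^ 4)"
  shows "integrable lborel (\<lambda>t. sqrt (cdf M t * (1 - cdf M t)))"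
proof -
  define m where "m = (\<integral>x. x ^ 4 \<partial>M)"
  have m0: "m \<ge> 0" unfolding m_def by simp
  have tail: "t ^ 4 * (cdf M t * (1 - cdf M t)) \<le> m" for t
  proof -
    have F: "0 \<le> cdf M t" "cdf M t \<le> 1" by (auto simp: cdf_nonneg cdf_bounded_prob)
    have chebyshev: "t ^ 4 * measure M A \<le> m"
      if [measurable]: "A \<in> sets borel" and le: "\<And>x. x \<in> A \<Longrightarrow> \<bar>t\<bar> \<le> \<bar>x\<bar>" for A
    proof -
      have "t ^ 4 * indicat_real A x \<le> x ^ 4" for x
        using power_mono[OF le, of x 4] by (auto simp: indicator_def)
      moreover have "integrable M (indicat_real A)"
        by (simp add: integrable_indicator_iff emeasure_eq_measure)
      ultimately have "(\<integral>x. t ^ 4 * indicat_real A x \<partial>M) \<le> m"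
        unfolding m_def using assms by (intro integral_mono) auto
      then show ?thesis by simp
    qed
    show ?thesis
    proof (cases "t \<ge> 0")
      case True
      have "1 - cdf M t = measure M {t<..}"
        unfolding cdf_def using prob_compl[of "{..t}"] by (simp add: Compl_eq_Diff_UNIV[symmetric])
      then have "t ^ 4 * (1 - cdf M t) \<le> m"
        using chebyshev[of "{t<..}"] True by simp
      moreover have "cdf M t * (t ^ 4 * (1 - cdf M t)) \<le> 1 * (t ^ 4 * (1 - cdf M t))"
        using F by (intro mult_right_mono) auto
      ultimately show ?thesis by (simp add: mult_ac)
    next
      case False
      then have "t ^ 4 * cdf M t \<le> m"
        unfolding cdf_def by (intro chebyshev) auto
      moreover have "(1 - cdf M t) * (t ^ 4 * cdf M t) \<le> 1 * (t ^ 4 * cdf M t)"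
        using F by (intro mult_right_mono) auto
      ultimately show ?thesis by (simp add: mult_ac)
    qed
  qed
  have [measurable]: "cdf M \<in> borel_measurable borel"
    by (intro borel_measurable_mono monoI cdf_nondecreasing)
  have bound: "sqrt (cdf M t * (1 - cdf M t)) \<le> sqrt (2 * (1 + m)) * inverse (1 + t\<^sup>2)" for t
  proof -
    have F: "0 \<le> cdf M t" "cdf M t \<le> 1" by (auto simp: cdf_nonneg cdf_bounded_prob)
    have pos: "0 < 1 + t\<^sup>2" by (simp add: add_pos_nonneg)
    have "(1 + t\<^sup>2)\<^sup>2 \<le> 2 * (1 + t ^ 4)"
      using zero_le_power2[of "1 - t\<^sup>2"] by (simp add: power2_eq_square power4_eq_xxxx algebra_simps)
    then have "cdf M t * (1 - cdf M t) * (1 + t\<^sup>2)\<^sup>2 \<le> cdf M t * (1 - cdf M t) * (2 * (1 + t ^ 4))"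
      using F by (intro mult_left_mono) auto
    also have "\<dots> = 2 * (cdf M t * (1 - cdf M t) + t ^ 4 * (cdf M t * (1 - cdf M t)))"
      by (simp add: algebra_simps)
    also have "\<dots> \<le> 2 * (1 + m)"
      using tail[of t] mult_mono[of "cdf M t" 1 "1 - cdf M t" 1] F by simp
    finally have "sqrt (cdf M t * (1 - cdf M t) * (1 + t\<^sup>2)\<^sup>2) \<le> sqrt (2 * (1 + m))"
      by (rule real_sqrt_le_mono)
    then have "sqrt (cdf M t * (1 - cdf M t)) * (1 + t\<^sup>2) \<le> sqrt (2 * (1 + m))"
      using pos by (simp add: real_sqrt_mult)
    then show ?thesis
      using pos by (simp add: field_simps)
  qed
  have "integrable lborel (\<lambda>t::real. inverse (1 + t\<^sup>2))"
    using integrable_inverse_1_plus_square by (simp add: set_integrable_def)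
  then have "integrable lborel (\<lambda>t. sqrt (2 * (1 + m)) * inverse (1 + t\<^sup>2))"
    by simp
  then show ?thesis
  proof (rule Bochner_Integration.integrable_bound)
    show "AE t in lborel. norm (sqrt (cdf M t * (1 - cdf M t)))
        \<le> norm (sqrt (2 * (1 + m)) * inverse (1 + t\<^sup>2))"
    proof (rule AE_I2)
      fix t
      have "0 \<le> cdf M t * (1 - cdf M t)"
        by (simp add: cdf_nonneg cdf_bounded_prob)
      then show "norm (sqrt (cdf M t * (1 - cdf M t)))
          \<le> norm (sqrt (2 * (1 + m)) * inverse (1 + t\<^sup>2))"
        using bound[of t] by (simp add: abs_of_nonneg del: inverse_eq_divide)
    qed
  qed measurable
qed

section \<open>The mean Wasserstein distance of the empirical measure\<close>

theorem proposition4p4: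
  fixes \<mu> :: "real measure" and N :: nat and F :: "real \<Rightarrow> real"
  assumes "real_distribution \<mu>"
    and "integrable \<mu> (\<lambda>x. x ^ 4)"
    and "F = cdf \<mu>"
    and "N \<ge> 1"
  shows "(\<lambda>\<xi>. wasserstein1 (empirical_measure N \<xi>) \<mu>)
           \<in> borel_measurable (\<Pi>\<^sub>M j\<in>{1..N}. \<mu>) \<and>
         integrable lborel (\<lambda>t. sqrt (F t * (1 - F t))) \<and>
         (\<integral>\<^sup>+ \<xi>. wasserstein1 (empirical_measure N \<xi>) \<mu> \<partial>(\<Pi>\<^sub>M j\<in>{1..N}. \<mu>))
           \<le> ennreal (1 / sqrt (real N) * (LBINT t. sqrt (F t * (1 - F t))))"
proof (intro conjI)
  interpret M: real_distribution \<mu> by fact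
  let ?P = "\<Pi>\<^sub>M j\<in>{1..N}. \<mu>"
  interpret P: product_prob_space "\<lambda>_. \<mu>" "{1..N}" ..
  interpret PL: pair_sigma_finite ?P lborel ..
  have W: "wasserstein1 (empirical_measure N \<xi>) \<mu> =
      (\<integral>\<^sup>+ t. ennreal \<bar>cdf (empirical_measure N \<xi>) t - F t\<bar> \<partial>lborel)" for \<xi>
    unfolding \<open>F = cdf \<mu>\<close>
    by (intro wasserstein1_eq_nn_integral_cdf real_distribution_empirical_measure assms)
  have [measurable]: "F \<in> borel_measurable borel"
    unfolding \<open>F = cdf \<mu>\<close> by (intro borel_measurable_mono monoI M.cdf_nondecreasing)
  have meas [measurable]:
    "(\<lambda>(\<xi>, t). ennreal \<bar>cdf (empirical_measure N \<xi>) t - F t\<bar>) \<in> borel_measurable (?P \<Otimes>\<^sub>M lborel)"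
    unfolding cdf_empirical_measure by measurable
  show "(\<lambda>\<xi>. wasserstein1 (empirical_measure N \<xi>) \<mu>) \<in> borel_measurable ?P"
    unfolding W by measurable
  show int: "integrable lborel (\<lambda>t. sqrt (F t * (1 - F t)))"
    unfolding \<open>F = cdf \<mu>\<close> by (rule M.integrable_sqrt_cdf) fact
  have "(\<integral>\<^sup>+ \<xi>. wasserstein1 (empirical_measure N \<xi>) \<mu> \<partial>?P) =
      (\<integral>\<^sup>+ t. \<integral>\<^sup>+ \<xi>. ennreal \<bar>cdf (empirical_measure N \<xi>) t - F t\<bar> \<partial>?P \<partial>lborel)"
    unfolding W by (rule PL.Fubini'[symmetric]) (rule meas)
  also have "\<dots> \<le> (\<integral>\<^sup>+ t. ennreal (1 / sqrt (real N) * sqrt (F t * (1 - F t))) \<partial>lborel)"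
    unfolding \<open>F = cdf \<mu>\<close>
    by (intro nn_integral_mono M.nn_integral_abs_cdf_empirical_diff_le assms)
  also have "\<dots> = ennreal (LBINT t. 1 / sqrt (real N) * sqrt (F t * (1 - F t)))"
    using int unfolding \<open>F = cdf \<mu>\<close>
    by (intro nn_integral_eq_integral)
      (auto simp: M.cdf_nonneg M.cdf_bounded_prob)
  also have "(LBINT t. 1 / sqrt (real N) * sqrt (F t * (1 - F t))) =
      1 / sqrt (real N) * (LBINT t. sqrt (F t * (1 - F t)))"
    by (rule integral_mult_right_zero)
  finally show "(\<integral>\<^sup>+ \<xi>. wasserstein1 (empirical_measure N \<xi>) \<mu> \<partial>?P)
      \<le> ennreal (1 / sqrt (real N) * (LBINT t. sqrt (F t * (1 - F t))))" .
qed

end
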